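(* Let $h(x)=\max\{h_i(x):i\in\mathbb I_q\}$, $\mathbb I_q=\{1,\dots,q\}$, with each $h_i$ convex (possibly nonsmooth) on $X$. Assume that for each $i\in\mathbb I_q$, $\tilde h_{i,\mu}$ is a smoothing function of $h_i$ with parameters $(\kappa_i,K_i,\mathcal L_{h_i})$. Let $$\tilde h_\mu(x)=\mu\ln\left(\sum_{i=1}^q e^{\tilde h_{i,\mu}(x)/\mu}\right).$$ Assume also that for each $i\in\mathbb I_q$ there exists a constant $M_i\ge0$, independent of $x\in X$ and $\mu\in(0,\bar\mu]$, such that $$\max_{x\in X,\ \mu\in(0,\bar\mu]}\left\{\|\nabla\tilde h_{i,\mu}(x)\|\right\}\le M_i<\infty.$$ Then: (i) $\tilde h_\mu$ is a smoothing function of $h$ with parameters $(\kappa,K,\mathcal L_h)$, where $$\kappa=\ln q+\sqrt{\sum_{i=1}^q\kappa_i^2},\qquad K=\sum_{i=1}^qK_i,\qquad \mathcal L_h=\left(\sum_{i=1}^qM_i\right)^2+\sum_{i=1}^q\mathcal L_{h_i}.$$ (ii) The unbiasedness and bounded-variance condition holds for the stochastic gradient $\nabla\tilde{\mathbf\Psi}_\mu(x,\zeta)$ with $\zeta=i$ and $\sigma^2=\mathbb E_i\left[(M_i)^2\right]$.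
   Context: **Setting.** $X\subseteq\mathbb R^d$ is closed and convex; $f:X\to\mathbb R$ is convex with Lipschitz gradient; $\bar\mu>0$; $\|\cdot\|$ is the Euclidean norm. **Smoothing function.** For convex $c:X\to\mathbb R$, a function $\tilde c:X\times(0,\bar\mu]\to\mathbb R$ (write $\tilde c_\mu=\tilde c(\cdot,\mu)$) is a smoothing function of $c$ with parameters $(\kappa,K,\mathcal L_c)$ if for every $\mu\in(0,\bar\mu]$, $\tilde c_\mu$ is continuously differentiable on $X$ and: (a) $\lim_{z\to x,\mu\downarrow0}\tilde c(z,\mu)=c(x)$ for all $x\in X$; (b) $\tilde c_\mu$ is convex on $X$; (c) $|\tilde c(x,\mu_2)-\tilde c(x,\mu_1)|\le\kappa|\mu_1-\mu_2|$ for all $x\in X$, $\mu_1,\mu_2\in(0,\bar\mu]$, with constant $\kappa>0$; (d) $\nabla\tilde c_\mu$ is Lipschitz on $X$ with constant $K+\mathcal L_c/\mu$, where $K$ and $\mathcal L_c>0$ do not depend on $\mu$. **Stochastic gradient.** For given $x\in X$, $\mu\in(0,\bar\mu]$, the index $i$ is a random variable on $\mathbb I_q$ with probabilities $p_{x,\mu}(i)=e^{\tilde h_{i,\mu}(x)/\mu}\big/\sum_{j=1}^qe^{\tilde h_{j,\mu}(x)/\mu}$; $\mathbb E_i$ is the expectation with respect to it. $\tilde\psi_\mu=f+\tilde h_\mu$ and $\nabla\tilde{\mathbf\Psi}_\mu(x,i)=\nabla f(x)+\nabla\tilde h_{i,\mu}(x)$. **Unbiasedness and bounded-variance condition** (with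 $\sigma^2$): for every $x\in X$ and $\mu\in(0,\bar\mu]$, $\mathbb E_\zeta[\nabla\tilde{\mathbf\Psi}_\mu(x,\zeta)]=\nabla\tilde\psi_\mu(x)$ and $\mathbb E_\zeta[\|\nabla\tilde{\mathbf\Psi}_\mu(x,\zeta)-\nabla\tilde\psi_\mu(x)\|^2]\le\sigma^2$. *)

theory Defs
  imports "HOL-Probability.Probability"
begin

text \<open>
  The functions of interest live on a closed convex set \<open>X\<close> only, so derivatives are taken
  within \<open>X\<close>. If \<open>X\<close> has empty interior, a derivative within \<open>X\<close> is determined only on the
  direction space of \<open>X\<close>; the gradient is therefore the unique representing vector that lies in
  this space (existence and uniqueness are \<open>gradient_on_works\<close> and \<open>gradient_on_eqI\<close>). If \<open>X\<close> has
  nonempty interior, the direction space is everything and this is the usual gradient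
  (\<open>gradient_on_GDERIV\<close>).
\<close>

definition gradient_on :: "'a::euclidean_space set \<Rightarrow> ('a \<Rightarrow> real) \<Rightarrow> 'a \<Rightarrow> 'a" where
  "gradient_on X f x =
     (THE g. g \<in> span ((\<lambda>y. y - x) ` X) \<and> (f has_derivative (\<lambda>v. v \<bullet> g)) (at x within X))"

lemma gradient_on_unique:
  fixes X :: "'a::euclidean_space set"
  assumes X: "convex X" "x \<in> X"
    and g: "g \<in> span ((\<lambda>y. y - x) ` X)" "(f has_derivative (\<lambda>v. v \<bullet> g)) (at x within X)"
    and g': "g' \<in> span ((\<lambda>y. y - x) ` X)" "(f has_derivative (\<lambda>v. v \<bullet> g')) (at x within X)"
  shows "g = g'"
proof -
  have dir: "d \<bullet> g = d \<bullet> g'" if d: "d \<in> (\<lambda>y. y - x) ` X" for d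
  proof -
    define p where "p = (\<lambda>t::real. x + t *\<^sub>R d)"
    have pX: "p ` {0..1} \<subseteq> X"
    proof
      fix z assume "z \<in> p ` {0..1}"
      then obtain t where t: "0 \<le> t" "t \<le> 1" "z = x + t *\<^sub>R d" by (auto simp: p_def)
      from d obtain y where y: "y \<in> X" "d = y - x" by auto
      have "z = (1 - t) *\<^sub>R x + t *\<^sub>R y" using t y by (simp add: algebra_simps)
      then show "z \<in> X" using X y t by (simp add: convexD_alt)
    qed
    have p': "(p has_derivative (\<lambda>t. t *\<^sub>R d)) (at 0 within {0..1})"
      unfolding p_def by (auto intro!: derivative_eq_intros)
    have comp: "((\<lambda>t. f (p t)) has_vector_derivative (d \<bullet> u)) (at 0 within {0..1})"
      if u: "(f has_derivative (\<lambda>v. v \<bullet> u)) (at x within X)" for u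
    proof -
      have "(f has_derivative (\<lambda>v. v \<bullet> u)) (at (p 0) within p ` {0..1})"
        using has_derivative_subset[OF u pX] by (simp add: p_def)
      from has_derivative_in_compose[OF p' this] show ?thesis
        by (simp add: has_vector_derivative_def)
    qed
    have "at (0::real) within {0..1} \<noteq> bot"
      by (simp add: trivial_limit_within islimpt_Icc)
    then show ?thesis
      using vector_derivative_unique_within comp[OF g(2)] comp[OF g'(2)] by blast
  qed
  have "orthogonal (g - g') w" if "w \<in> span ((\<lambda>y. y - x) ` X)" for w
  proof (rule orthogonal_to_span[OF that])
    fix d assume "d \<in> (\<lambda>y. y - x) ` X"
    from dir[OF this] show "orthogonal (g - g') d"
      by (simp add: orthogonal_def inner_diff_right inner_commute)
  qed
  then have "orthogonal (g - g') (g - g')"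
    using g(1) g'(1) by (simp add: span_diff)
  then show ?thesis by (simp add: orthogonal_def)
qed

lemma gradient_on_eqI:
  fixes X :: "'a::euclidean_space set"
  assumes "convex X" "x \<in> X"
    and "g \<in> span ((\<lambda>y. y - x) ` X)" "(f has_derivative (\<lambda>v. v \<bullet> g)) (at x within X)"
  shows "gradient_on X f x = g"
  unfolding gradient_on_def using assms gradient_on_unique by (intro the_equality) blast+

lemma gradient_on_works:
  fixes X :: "'a::euclidean_space set"
  assumes X: "convex X" "x \<in> X" and f: "f differentiable (at x within X)"
  shows "gradient_on X f x \<in> span ((\<lambda>y. y - x) ` X)"
    and "(f has_derivative (\<lambda>v. v \<bullet> gradient_on X f x)) (at x within X)"
proof -
  let ?S = "(\<lambda>y. y - x) ` X"
  obtain D where D: "(f has_derivative D) (at x within X)"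
    using f unfolding differentiable_def by blast
  then interpret D: bounded_linear D by (rule has_derivative_bounded_linear)
  define w where "w = (\<Sum>b\<in>Basis. D b *\<^sub>R b)"
  have Dw: "D v = v \<bullet> w" for v
  proof -
    have "D v = D (\<Sum>b\<in>Basis. (v \<bullet> b) *\<^sub>R b)" by (simp add: euclidean_representation)
    also have "\<dots> = v \<bullet> w"
      by (simp add: w_def D.sum D.scaleR inner_sum_right mult.commute)
    finally show ?thesis .
  qed
  obtain g z where gz: "g \<in> span ?S" "\<And>u. u \<in> span ?S \<Longrightarrow> orthogonal z u" "w = g + z"
    by (rule orthogonal_subspace_decomp_exists[of ?S w]) blast
  have eq: "D (y - x) = (y - x) \<bullet> g" if "y \<in> X" for y
    using gz(2)[of "y - x"] that
    by (simp add: Dw gz(3) inner_add_right orthogonal_def inner_commute span_base)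
  have g': "(f has_derivative (\<lambda>v. v \<bullet> g)) (at x within X)"
    unfolding has_derivative_within
  proof
    show "bounded_linear (\<lambda>v. v \<bullet> g)" by (rule bounded_linear_inner_left)
    have "((\<lambda>y. (1 / norm (y - x)) *\<^sub>R (f y - (f x + D (y - x)))) \<longlongrightarrow> 0) (at x within X)"
      using D by (simp add: has_derivative_within)
    then show "((\<lambda>y. (1 / norm (y - x)) *\<^sub>R (f y - (f x + (y - x) \<bullet> g))) \<longlongrightarrow> 0) (at x within X)"
      by (rule Lim_transform_eventually) (auto simp: eventually_at_filter eq)
  qed
  show "gradient_on X f x \<in> span ?S"
    "(f has_derivative (\<lambda>v. v \<bullet> gradient_on X f x)) (at x within X)"
    using g' gz(1) gradient_on_eqI[OF X gz(1) g'] by simp_all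
qed

lemma gradient_on_GDERIV:
  fixes X :: "'a::euclidean_space set"
  assumes X: "convex X" "interior X \<noteq> {}" "x \<in> X" and f: "GDERIV f x :> g"
  shows "gradient_on X f x = g"
proof (rule gradient_on_eqI[OF X(1,3)])
  have "interior ((\<lambda>y. y - x) ` X) \<noteq> {}"
    using X(2) by (simp add: interior_translation_subtract)
  then have "span ((\<lambda>y. y - x) ` X) = UNIV"
    using empty_interior_lowdim[of "(\<lambda>y. y - x) ` X"] dim_subset_UNIV[of "(\<lambda>y. y - x) ` X"]
    by (metis dim_eq_full le_neq_implies_less)
  then show "g \<in> span ((\<lambda>y. y - x) ` X)" by simp
  show "(f has_derivative (\<lambda>v. v \<bullet> g)) (at x within X)"
    using f unfolding gderiv_def by (rule has_derivative_at_withinI)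
qed

text \<open>
  The smoothing parameter \<open>\<mu>\<close> comes first, so that \<open>ct \<mu>\<close> is the smoothed function; only its
  values on \<open>X\<close> for \<open>\<mu> \<in> {0<..\<mu>bar}\<close> matter. No sign is imposed on \<open>K\<close>.
\<close>

definition smoothing_function ::
  "'a::euclidean_space set \<Rightarrow> real \<Rightarrow> ('a \<Rightarrow> real) \<Rightarrow> (real \<Rightarrow> 'a \<Rightarrow> real)
     \<Rightarrow> real \<Rightarrow> real \<Rightarrow> real \<Rightarrow> bool" where
  "smoothing_function X \<mu>bar c ct \<kappa> K L \<longleftrightarrow>
     convex_on X c \<and> \<kappa> > 0 \<and> L > 0 \<and>
     (\<forall>\<mu>\<in>{0<..\<mu>bar}. ct \<mu> differentiable_on X \<and> continuous_on X (gradient_on X (ct \<mu>))) \<and>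
     (\<forall>x\<in>X. ((\<lambda>(z, \<mu>). ct \<mu> z) \<longlongrightarrow> c x) (at (x, 0) within X \<times> {0<..\<mu>bar})) \<and>
     (\<forall>\<mu>\<in>{0<..\<mu>bar}. convex_on X (ct \<mu>)) \<and>
     (\<forall>x\<in>X. \<forall>\<mu>1\<in>{0<..\<mu>bar}. \<forall>\<mu>2\<in>{0<..\<mu>bar}. \<bar>ct \<mu>2 x - ct \<mu>1 x\<bar> \<le> \<kappa> * \<bar>\<mu>1 - \<mu>2\<bar>) \<and>
     (\<forall>\<mu>\<in>{0<..\<mu>bar}. (K + L / \<mu>)-lipschitz_on X (gradient_on X (ct \<mu>)))"

definition log_sum_exp_smoothing ::
  "nat \<Rightarrow> (nat \<Rightarrow> real \<Rightarrow> 'a \<Rightarrow> real) \<Rightarrow> real \<Rightarrow> 'a \<Rightarrow> real" where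
  "log_sum_exp_smoothing q ht \<mu> x = \<mu> * ln (\<Sum>i=1..q. exp (ht i \<mu> x / \<mu>))"

definition index_prob ::
  "nat \<Rightarrow> (nat \<Rightarrow> real \<Rightarrow> 'a \<Rightarrow> real) \<Rightarrow> 'a \<Rightarrow> real \<Rightarrow> nat \<Rightarrow> real" where
  "index_prob q ht x \<mu> i =
     (if i \<in> {1..q} then exp (ht i \<mu> x / \<mu>) / (\<Sum>j=1..q. exp (ht j \<mu> x / \<mu>)) else 0)"

text \<open>The distribution of the random index; meaningful for \<open>q \<ge> 1\<close> (see \<open>pmf_index_pmf\<close>).\<close>

definition index_pmf ::
  "nat \<Rightarrow> (nat \<Rightarrow> real \<Rightarrow> 'a \<Rightarrow> real) \<Rightarrow> 'a \<Rightarrow> real \<Rightarrow> nat pmf" where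
  "index_pmf q ht x \<mu> = embed_pmf (index_prob q ht x \<mu>)"

lemma pmf_index_pmf:
  assumes "q \<ge> 1"
  shows "pmf (index_pmf q ht x \<mu>) i = index_prob q ht x \<mu> i"
  unfolding index_pmf_def
proof (rule pmf_embed_pmf)
  let ?Z = "\<Sum>j=1..q. exp (ht j \<mu> x / \<mu>)"
  have Z: "?Z > 0" using assms by (intro sum_pos) auto
  show nonneg: "0 \<le> index_prob q ht x \<mu> i" for i
    using Z by (simp add: index_prob_def)
  have "(\<integral>\<^sup>+i. ennreal (index_prob q ht x \<mu> i) \<partial>count_space UNIV)
      = (\<Sum>i=1..q. ennreal (index_prob q ht x \<mu> i))"
    by (rule nn_integral_count_space'[where A = "{1..q}"]) (auto simp: index_prob_def)
  also have "\<dots> = ennreal (\<Sum>i=1..q. index_prob q ht x \<mu> i)"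
    using nonneg by (simp add: sum_ennreal)
  also have "(\<Sum>i=1..q. index_prob q ht x \<mu> i) = (\<Sum>i=1..q. exp (ht i \<mu> x / \<mu>)) / ?Z"
    unfolding sum_divide_distrib by (rule sum.cong) (auto simp: index_prob_def)
  finally show "(\<integral>\<^sup>+i. ennreal (index_prob q ht x \<mu> i) \<partial>count_space UNIV) = 1"
    using Z by simp
qed

definition stochastic_gradient ::
  "'a::euclidean_space set \<Rightarrow> ('a \<Rightarrow> real) \<Rightarrow> (nat \<Rightarrow> real \<Rightarrow> 'a \<Rightarrow> real)
     \<Rightarrow> real \<Rightarrow> 'a \<Rightarrow> nat \<Rightarrow> 'a" where
  "stochastic_gradient X f ht \<mu> x i = gradient_on X f x + gradient_on X (ht i \<mu>) x"

text \<open>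
  The law \<open>P x \<mu>\<close> of the random variable may depend on \<open>x\<close> and \<open>\<mu>\<close>, and so may the variance
  bound \<open>\<sigma>2 x \<mu>\<close>.
\<close>

definition unbiased_bounded_variance ::
  "'a::euclidean_space set \<Rightarrow> real \<Rightarrow> (real \<Rightarrow> 'a \<Rightarrow> real) \<Rightarrow> ('a \<Rightarrow> real \<Rightarrow> 'z pmf)
     \<Rightarrow> (real \<Rightarrow> 'a \<Rightarrow> 'z \<Rightarrow> 'a) \<Rightarrow> ('a \<Rightarrow> real \<Rightarrow> real) \<Rightarrow> bool" where
  "unbiased_bounded_variance X \<mu>bar \<psi> P G \<sigma>2 \<longleftrightarrow>
     (\<forall>x\<in>X. \<forall>\<mu>\<in>{0<..\<mu>bar}.
        measure_pmf.expectation (P x \<mu>) (\<lambda>\<zeta>. G \<mu> x \<zeta>) = gradient_on X (\<psi> \<mu>) x \<and>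
        measure_pmf.expectation (P x \<mu>)
          (\<lambda>\<zeta>. (norm (G \<mu> x \<zeta> - gradient_on X (\<psi> \<mu>) x))\<^sup>2) \<le> \<sigma>2 x \<mu>)"

end

theory Submission
  imports Defs
begin

text \<open>
  Let \<open>lse a\<close> be the logarithm of \<open>\<Sum>i. exp (a i)\<close>. The smoothed maximum at temperature \<open>\<mu>\<close> is
  \<open>F a \<mu> = \<mu> * lse (a / \<mu>)\<close>, evaluated at \<open>a i = ht i \<mu> x\<close>. Almost everything follows from three
  elementary properties of \<open>lse\<close>: it is monotone, it commutes with adding a constant to every
  entry, and it is convex. All three come from the normalisation \<open>\<Sum>i. exp (a i - lse a) = 1\<close>.

  Monotonicity and translation make \<open>F\<close> nonexpansive in \<open>a\<close> for the maximum norm. For fixed \<open>a\<close>,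
  \<open>F\<close> is nondecreasing in \<open>\<mu>\<close> and grows by at most \<open>ln q\<close> per unit of temperature; this last bound is convexity
  of \<open>lse\<close> on the segment from \<open>a / s\<close> to \<open>0\<close>. The two estimates together
  (\<open>scaled_lse_joint_Lipschitz\<close>) bound the dependence on \<open>\<mu>\<close>, which enters \<open>F\<close> both as temperature
  and through the entries \<open>ht i \<mu> x\<close>, and with \<open>max a \<le> F a \<mu> \<le> max a + \<mu> ln q\<close> they give
  convergence to the maximum.

  The gradient of the smoothed maximum is the average of the gradients \<open>g i\<close> under the softmax
  weights \<open>p i\<close> (\<open>gradient_scaled_lse\<close>). Its Lipschitz constant has one part from varying the
  \<open>g i\<close> with fixed weights, at most the sum of their constants, and one from varying the weights:
  \<open>p i\<close> changes by at most \<open>\<Sum>j. \<bar>a j - b j\<bar>\<close> (\<open>softmax_Lipschitz\<close>), which for \<open>a = ht / \<mu>\<close> is at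
  most \<open>(\<Sum>j. M j) / \<mu>\<close> times the distance of the points; weighting by \<open>norm (g i) \<le> M i\<close> and
  summing over \<open>i\<close> produces \<open>(\<Sum>i. M i)\<^sup>2 / \<mu>\<close>.

  The random index has exactly the softmax weights as its law, so the same gradient formula is
  unbiasedness, and the variance is at most the second moment of \<open>g\<close>
  (\<open>weighted_variance_le\<close>).
\<close>

section \<open>Log-sum-exp: normalisation, monotonicity and convexity\<close>

definition lse :: "'i set \<Rightarrow> ('i \<Rightarrow> real) \<Rightarrow> real" where
  "lse I a = ln (\<Sum>i\<in>I. exp (a i))"

definition softmax :: "'i set \<Rightarrow> ('i \<Rightarrow> real) \<Rightarrow> 'i \<Rightarrow> real" where
  "softmax I a i = exp (a i) / (\<Sum>j\<in>I. exp (a j))"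

lemma sum_exp_pos:
  assumes "finite I" "I \<noteq> {}"
  shows "(\<Sum>i\<in>I. exp (a i :: real)) > 0"
  using assms by (intro sum_pos) auto

lemma exp_lse:
  assumes "finite I" "I \<noteq> {}"
  shows "exp (lse I a) = (\<Sum>i\<in>I. exp (a i))"
  using sum_exp_pos[OF assms] by (simp add: lse_def)

lemma lse_le_iff:
  assumes "finite I" "I \<noteq> {}"
  shows "lse I a \<le> c \<longleftrightarrow> (\<Sum>i\<in>I. exp (a i - c)) \<le> 1"
proof -
  have "lse I a \<le> c \<longleftrightarrow> (\<Sum>i\<in>I. exp (a i)) \<le> exp c"
    by (simp add: exp_lse[OF assms, symmetric])
  then show ?thesis
    by (simp add: exp_diff flip: sum_divide_distrib)
qed

lemma sum_exp_minus_lse: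
  assumes "finite I" "I \<noteq> {}"
  shows "(\<Sum>i\<in>I. exp (a i - lse I a)) = 1"
  using sum_exp_pos[OF assms, of a]
  by (simp add: exp_diff exp_lse[OF assms] flip: sum_divide_distrib)

lemma lse_ge:
  assumes "finite I" "i \<in> I"
  shows "a i \<le> lse I a"
proof -
  have "exp (a i) \<le> (\<Sum>i\<in>I. exp (a i))"
    using assms by (intro member_le_sum) auto
  also have "\<dots> = exp (lse I a)"
    using assms by (subst exp_lse) auto
  finally show ?thesis by simp
qed

text \<open>
  Monotonicity and translation at once: dividing by \<open>exp (lse I b + c)\<close> turns the claim into a
  termwise comparison with the normalised sum of \<open>b\<close>.
\<close>

lemma lse_le_shift:
  assumes "finite I" "I \<noteq> {}" and "\<And>i. i \<in> I \<Longrightarrow> a i \<le> b i + c"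
  shows "lse I a \<le> lse I b + c"
proof -
  have "(\<Sum>i\<in>I. exp (a i - (lse I b + c))) \<le> (\<Sum>i\<in>I. exp (b i - lse I b))"
    using assms(3) by (intro sum_mono) (simp add: algebra_simps)
  then show ?thesis
    using assms by (simp add: lse_le_iff sum_exp_minus_lse)
qed

lemma lse_const:
  assumes "finite I" "I \<noteq> {}"
  shows "lse I (\<lambda>_. c) = ln (real (card I)) + c"
  using assms by (simp add: lse_def ln_mult card_gt_0_iff)

text \<open>
  This is Hoelder's inequality for sums of exponentials. After normalisation of both sums it
  reduces to convexity of \<open>exp\<close> in each term.
\<close>

lemma lse_convex:
  assumes "finite I" "I \<noteq> {}" and "0 \<le> s" "0 \<le> t" "s + t = 1"
  shows "lse I (\<lambda>i. s * a i + t * b i) \<le> s * lse I a + t * lse I b"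
proof -
  have "exp (s * a i + t * b i - (s * lse I a + t * lse I b))
      \<le> s * exp (a i - lse I a) + t * exp (b i - lse I b)" for i
  proof -
    have "s * a i + t * b i - (s * lse I a + t * lse I b)
        = s * (a i - lse I a) + t * (b i - lse I b)"
      by (simp add: algebra_simps)
    then show ?thesis
      using convex_onD[OF exp_convex, of t "a i - lse I a" "b i - lse I b"] assms(3-5)
      by (simp add: eq_diff_eq[symmetric])
  qed
  then have "(\<Sum>i\<in>I. exp (s * a i + t * b i - (s * lse I a + t * lse I b)))
      \<le> (\<Sum>i\<in>I. s * exp (a i - lse I a) + t * exp (b i - lse I b))"
    by (intro sum_mono)
  also have "\<dots> = 1"
    using assms by (simp add: sum.distrib sum_exp_minus_lse flip: sum_distrib_left)
  finally show ?thesis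
    using assms by (simp add: lse_le_iff)
qed

section \<open>Dependence on the temperature\<close>

lemma scaled_lse_le_shift:
  assumes "finite I" "I \<noteq> {}" "\<mu> > 0" and "\<And>i. i \<in> I \<Longrightarrow> a i \<le> b i + c"
  shows "\<mu> * lse I (\<lambda>i. a i / \<mu>) \<le> \<mu> * lse I (\<lambda>i. b i / \<mu>) + c"
proof -
  have "lse I (\<lambda>i. a i / \<mu>) \<le> lse I (\<lambda>i. b i / \<mu>) + c / \<mu>"
    using assms by (intro lse_le_shift) (auto simp: divide_right_mono simp flip: add_divide_distrib)
  then show ?thesis
    using \<open>\<mu> > 0\<close> by (simp add: field_simps)
qed

text \<open>
  With \<open>F\<close> the value at temperature \<open>s\<close>, every \<open>a i - F\<close> is nonpositive; a larger temperature
  therefore raises each term \<open>exp ((a i - F) / s)\<close>, whose sum was \<open>1\<close>.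
\<close>

lemma scaled_lse_mono_temperature:
  assumes I: "finite I" "I \<noteq> {}" and "0 < s" "s \<le> t"
  shows "s * lse I (\<lambda>i. a i / s) \<le> t * lse I (\<lambda>i. a i / t)"
proof -
  define F where "F = s * lse I (\<lambda>i. a i / s)"
  have "a i / s - F / s \<le> a i / t - F / t" if "i \<in> I" for i
  proof -
    have "a i - F \<le> 0"
      using lse_ge[OF I(1) that, of "\<lambda>i. a i / s"] \<open>0 < s\<close> by (simp add: F_def field_simps)
    then have "(a i - F) / s \<le> (a i - F) / t"
      using assms(3,4) by (intro divide_left_mono_neg) auto
    then show ?thesis by (simp add: diff_divide_distrib)
  qed
  then have "lse I (\<lambda>i. a i / s) \<le> lse I (\<lambda>i. a i / t) + (F / s - F / t)"
    using I by (intro lse_le_shift) (auto simp: algebra_simps)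
  then have "F / t \<le> lse I (\<lambda>i. a i / t)"
    using \<open>0 < s\<close> by (simp add: F_def)
  then show ?thesis
    using assms(3,4) by (simp add: F_def[symmetric] field_simps)
qed

text \<open>
  As \<open>a / t\<close> is the convex combination of \<open>a / s\<close> and \<open>0\<close> with weight \<open>s / t\<close>, convexity bounds
  \<open>lse\<close> at \<open>a / t\<close>, with \<open>lse 0 = ln (card I)\<close> as the source of the logarithm.
\<close>

lemma scaled_lse_temperature_growth:
  assumes I: "finite I" "I \<noteq> {}" and "0 < s" "s \<le> t"
  shows "t * lse I (\<lambda>i. a i / t) \<le> s * lse I (\<lambda>i. a i / s) + (t - s) * ln (real (card I))"
proof -
  have "lse I (\<lambda>i. (s / t) * (a i / s) + (1 - s / t) * 0)
      \<le> (s / t) * lse I (\<lambda>i. a i / s) + (1 - s / t) * lse I (\<lambda>_. 0)"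
    using assms by (intro lse_convex) auto
  then have "lse I (\<lambda>i. a i / t)
      \<le> (s / t) * lse I (\<lambda>i. a i / s) + (1 - s / t) * ln (real (card I))"
    using assms by (simp add: lse_const)
  then have "t * lse I (\<lambda>i. a i / t)
      \<le> t * ((s / t) * lse I (\<lambda>i. a i / s) + (1 - s / t) * ln (real (card I)))"
    using assms by (intro mult_left_mono) auto
  also have "\<dots> = s * lse I (\<lambda>i. a i / s) + (t - s) * ln (real (card I))"
    using assms by (simp add: field_simps)
  finally show ?thesis .
qed

lemma scaled_lse_bounds:
  assumes I: "finite I" "I \<noteq> {}" and "\<mu> > 0"
  shows "(MAX i\<in>I. a i) \<le> \<mu> * lse I (\<lambda>i. a i / \<mu>)"
    and "\<mu> * lse I (\<lambda>i. a i / \<mu>) \<le> (MAX i\<in>I. a i) + \<mu> * ln (real (card I))"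
proof -
  have "a i \<le> \<mu> * lse I (\<lambda>i. a i / \<mu>)" if "i \<in> I" for i
    using lse_ge[OF I(1) that, of "\<lambda>i. a i / \<mu>"] \<open>\<mu> > 0\<close> by (simp add: field_simps)
  then show "(MAX i\<in>I. a i) \<le> \<mu> * lse I (\<lambda>i. a i / \<mu>)"
    using I by simp
  have "\<mu> * lse I (\<lambda>i. a i / \<mu>) \<le> \<mu> * lse I (\<lambda>_. 0 / \<mu>) + (MAX i\<in>I. a i)"
    using assms by (intro scaled_lse_le_shift) auto
  then show "\<mu> * lse I (\<lambda>i. a i / \<mu>) \<le> (MAX i\<in>I. a i) + \<mu> * ln (real (card I))"
    using I by (simp add: lse_const)
qed

text \<open>
  Temperature and arguments are changed one after the other, since both depend on the smoothing
  parameter when the arguments are themselves smoothed functions.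
\<close>

lemma scaled_lse_joint_Lipschitz:
  assumes I: "finite I" "I \<noteq> {}" and st: "0 < s" "0 < t"
    and ab: "\<And>i. i \<in> I \<Longrightarrow> \<bar>a i - b i\<bar> \<le> c"
  shows "\<bar>t * lse I (\<lambda>i. a i / t) - s * lse I (\<lambda>i. b i / s)\<bar>
           \<le> \<bar>s - t\<bar> * ln (real (card I)) + c"
proof -
  have "card I \<ge> 1"
    using I by (simp add: Suc_le_eq card_gt_0_iff)
  then have "0 \<le> ln (real (card I))" by simp
  then have ln0: "0 \<le> \<bar>s - t\<bar> * ln (real (card I))"
    by simp
  have "t * lse I (\<lambda>i. a i / t) \<le> s * lse I (\<lambda>i. a i / s) + \<bar>s - t\<bar> * ln (real (card I))"
    "s * lse I (\<lambda>i. a i / s) \<le> t * lse I (\<lambda>i. a i / t) + \<bar>s - t\<bar> * ln (real (card I))"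
    using scaled_lse_mono_temperature[OF I, of s t a] scaled_lse_temperature_growth[OF I, of s t a]
      scaled_lse_mono_temperature[OF I, of t s a] scaled_lse_temperature_growth[OF I, of t s a]
      st ln0 by (cases "s \<le> t"; simp)+
  moreover have "s * lse I (\<lambda>i. a i / s) \<le> s * lse I (\<lambda>i. b i / s) + c"
    "s * lse I (\<lambda>i. b i / s) \<le> s * lse I (\<lambda>i. a i / s) + c"
    using I st ab by (intro scaled_lse_le_shift; fastforce simp: abs_le_iff)+
  ultimately show ?thesis by (simp add: abs_le_iff)
qed

text \<open>
  The arguments are first replaced by their limits at the current temperature, where the
  two-sided bound of the smoothed maximum applies. The temperature is itself a function along
  the filter, so that a joint limit in point and parameter is covered.
\<close>

lemma tendsto_scaled_lse_MAX:
  assumes I: "finite I" "I \<noteq> {}"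
    and a: "\<And>i. i \<in> I \<Longrightarrow> ((\<lambda>w. a i w) \<longlongrightarrow> b i) F"
    and \<mu>: "(\<mu> \<longlongrightarrow> 0) F" "eventually (\<lambda>w. \<mu> w > 0) F"
  shows "((\<lambda>w. \<mu> w * lse I (\<lambda>i. a i w / \<mu> w)) \<longlongrightarrow> (MAX i\<in>I. b i)) F"
proof -
  let ?B = "\<lambda>w. \<mu> w * ln (real (card I)) + (\<Sum>i\<in>I. \<bar>a i w - b i\<bar>)"
  have "((\<lambda>w. \<Sum>i\<in>I. \<bar>a i w - b i\<bar>) \<longlongrightarrow> (\<Sum>i\<in>I. \<bar>b i - b i\<bar>)) F"
    by (intro tendsto_sum tendsto_rabs tendsto_diff a tendsto_const)
  from tendsto_add[OF tendsto_mult_right[OF \<mu>(1), of "ln (real (card I))"] this]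
  have B: "(?B \<longlongrightarrow> 0) F" by simp
  have "eventually (\<lambda>w. norm (\<mu> w * lse I (\<lambda>i. a i w / \<mu> w) - (MAX i\<in>I. b i)) \<le> ?B w) F"
    using \<mu>(2)
  proof eventually_elim
    case (elim w)
    have "\<bar>a i w - b i\<bar> \<le> (\<Sum>i\<in>I. \<bar>a i w - b i\<bar>)" if "i \<in> I" for i
      using I that by (intro member_le_sum) auto
    then have "\<bar>\<mu> w * lse I (\<lambda>i. a i w / \<mu> w) - \<mu> w * lse I (\<lambda>i. b i / \<mu> w)\<bar>
        \<le> (\<Sum>i\<in>I. \<bar>a i w - b i\<bar>)"
      using scaled_lse_joint_Lipschitz[OF I elim elim, of "\<lambda>i. a i w" b] by simp
    with scaled_lse_bounds[OF I elim, of b] show ?case by simp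
  qed
  from Lim_null_comparison[OF this B] show ?thesis by (simp add: LIM_zero_iff)
qed

section \<open>Softmax weights\<close>

lemma softmax_nonneg: "0 \<le> softmax I a i"
  by (simp add: softmax_def sum_nonneg)

lemma softmax_eq_exp:
  assumes "finite I" "I \<noteq> {}"
  shows "softmax I a i = exp (a i - lse I a)"
  by (simp add: softmax_def exp_diff exp_lse[OF assms])

lemma sum_softmax:
  assumes "finite I" "I \<noteq> {}"
  shows "(\<Sum>i\<in>I. softmax I a i) = 1"
  using sum_exp_pos[OF assms, of a] by (simp add: softmax_def flip: sum_divide_distrib)

lemma softmax_le_1:
  assumes "finite I" "i \<in> I"
  shows "softmax I a i \<le> 1"
proof -
  have "softmax I a i \<le> (\<Sum>i\<in>I. softmax I a i)"
    using assms by (intro member_le_sum) (auto simp: softmax_nonneg)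
  then show ?thesis
    using assms by (subst (asm) sum_softmax) auto
qed

text \<open>
  Passing from \<open>b\<close> to \<open>a\<close> multiplies the \<open>i\<close>-th weight by at least
  \<open>exp (- D)\<close> with \<open>D = (\<Sum>j\<in>I. \<bar>a j - b j\<bar>)\<close>, and \<open>exp (- D) \<ge> 1 - D\<close>.
\<close>

lemma softmax_Lipschitz:
  assumes I: "finite I" "i \<in> I"
  shows "\<bar>softmax I a i - softmax I b i\<bar> \<le> (\<Sum>j\<in>I. \<bar>a j - b j\<bar>)"
proof -
  have one_sided: "softmax I b i - (\<Sum>j\<in>I. \<bar>a j - b j\<bar>) \<le> softmax I a i" for a b
  proof -
    define D where "D = (\<Sum>j\<in>I. \<bar>a j - b j\<bar>)"
    \<comment> \<open>If \<open>j \<noteq> i\<close>, the entries \<open>i\<close> and \<open>j\<close> are counted separately in \<open>D\<close>.\<close>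
    have D: "(a j - b j) - (a i - b i) \<le> D" if j: "j \<in> I" for j
    proof (cases "j = i")
      case True
      then show ?thesis by (simp add: D_def sum_nonneg)
    next
      case False
      have "(\<Sum>k\<in>{i, j}. \<bar>a k - b k\<bar>) \<le> D"
        unfolding D_def using I j by (intro sum_mono2) auto
      then show ?thesis using False by auto
    qed
    have I': "I \<noteq> {}" using I by auto
    have "lse I a \<le> lse I b + (D + (a i - b i))"
      using I I' by (intro lse_le_shift) (auto dest: D)
    then have "exp (b i - lse I b - D) \<le> exp (a i - lse I a)"
      by simp
    then have "softmax I b i * exp (- D) \<le> softmax I a i"
      using I I' by (simp add: softmax_eq_exp mult_exp_exp)
    moreover have "softmax I b i * (1 - D) \<le> softmax I b i * exp (- D)"
      using exp_ge_add_one_self[of "- D"] by (intro mult_left_mono) (auto simp: softmax_nonneg)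
    moreover have "softmax I b i * D \<le> 1 * D"
      using I by (intro mult_right_mono softmax_le_1) (auto simp: D_def sum_nonneg)
    ultimately show ?thesis
      by (simp add: D_def[symmetric] algebra_simps)
  qed
  show ?thesis
    using one_sided[of a b] one_sided[of b a] by (simp add: abs_le_iff abs_minus_commute)
qed

section \<open>Gradient of the smoothed maximum\<close>

lemma has_derivative_scaled_lse:
  fixes \<phi> :: "'i \<Rightarrow> 'a::real_inner \<Rightarrow> real"
  assumes I: "finite I" "I \<noteq> {}" and "\<mu> > 0"
    and \<phi>: "\<And>i. i \<in> I \<Longrightarrow> (\<phi> i has_derivative (\<lambda>v. v \<bullet> g i)) (at x within X)"
  shows "((\<lambda>x. \<mu> * lse I (\<lambda>i. \<phi> i x / \<mu>)) has_derivative
           (\<lambda>v. v \<bullet> (\<Sum>i\<in>I. softmax I (\<lambda>i. \<phi> i x / \<mu>) i *\<^sub>R g i))) (at x within X)"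
proof -
  define Z where "Z = (\<Sum>j\<in>I. exp (\<phi> j x / \<mu>))"
  have Z: "Z > 0" unfolding Z_def by (rule sum_exp_pos[OF I])
  have "((\<lambda>x. \<Sum>i\<in>I. exp (\<phi> i x / \<mu>)) has_derivative
      (\<lambda>v. \<Sum>i\<in>I. exp (\<phi> i x / \<mu>) * ((v \<bullet> g i) / \<mu>))) (at x within X)"
    using \<open>\<mu> > 0\<close> by (auto intro!: derivative_eq_intros \<phi> simp: field_simps)
  from has_derivative_mult_right[OF has_derivative_ln[OF Z[unfolded Z_def] this], of \<mu>]
  show ?thesis
    unfolding lse_def
  proof (rule has_derivative_eq_rhs)
    show "(\<lambda>v. \<mu> * ((\<Sum>i\<in>I. exp (\<phi> i x / \<mu>) * ((v \<bullet> g i) / \<mu>)) *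
             inverse (\<Sum>i\<in>I. exp (\<phi> i x / \<mu>))))
        = (\<lambda>v. v \<bullet> (\<Sum>i\<in>I. softmax I (\<lambda>i. \<phi> i x / \<mu>) i *\<^sub>R g i))"
      using \<open>\<mu> > 0\<close> by (intro ext)
        (simp add: softmax_def inner_sum_right sum_distrib_left sum_distrib_right field_simps
           flip: Z_def)
  qed
qed

lemma gradient_scaled_lse:
  fixes X :: "'a::euclidean_space set" and \<phi> :: "'i \<Rightarrow> 'a \<Rightarrow> real"
  assumes X: "convex X" "x \<in> X" and I: "finite I" "I \<noteq> {}" and "\<mu> > 0"
    and \<phi>: "\<And>i. i \<in> I \<Longrightarrow> \<phi> i differentiable (at x within X)"
  shows "(\<lambda>x. \<mu> * lse I (\<lambda>i. \<phi> i x / \<mu>)) differentiable (at x within X)"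
    and "gradient_on X (\<lambda>x. \<mu> * lse I (\<lambda>i. \<phi> i x / \<mu>)) x
       = (\<Sum>i\<in>I. softmax I (\<lambda>i. \<phi> i x / \<mu>) i *\<^sub>R gradient_on X (\<phi> i) x)"
proof -
  note works = gradient_on_works[OF X \<phi>]
  note D = has_derivative_scaled_lse[OF I \<open>\<mu> > 0\<close> works(2)]
  show "(\<lambda>x. \<mu> * lse I (\<lambda>i. \<phi> i x / \<mu>)) differentiable (at x within X)"
    using D by (rule differentiableI)
  show "gradient_on X (\<lambda>x. \<mu> * lse I (\<lambda>i. \<phi> i x / \<mu>)) x
       = (\<Sum>i\<in>I. softmax I (\<lambda>i. \<phi> i x / \<mu>) i *\<^sub>R gradient_on X (\<phi> i) x)"
    by (intro gradient_on_eqI[OF X _ D] span_sum span_scale works(1))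
qed

text \<open>
  Bounding the gradient within \<open>X\<close> suffices, as the mean value inequality on a convex set only
  uses derivatives within that set.
\<close>

lemma bounded_gradient_Lipschitz:
  fixes X :: "'a::euclidean_space set"
  assumes X: "convex X" and f: "f differentiable_on X"
    and M: "\<And>x. x \<in> X \<Longrightarrow> norm (gradient_on X f x) \<le> M"
    and xy: "x \<in> X" "y \<in> X"
  shows "\<bar>f x - f y\<bar> \<le> M * norm (x - y)"
proof -
  have "norm (f x - f y) \<le> M * norm (x - y)"
  proof (rule differentiable_bound[OF X _ _ xy])
    fix z assume z: "z \<in> X"
    show "(f has_derivative (\<lambda>v. v \<bullet> gradient_on X f z)) (at z within X)"
      using f z by (intro gradient_on_works[OF X z]) (simp add: differentiable_on_def)
    show "onorm (\<lambda>v. v \<bullet> gradient_on X f z) \<le> M"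
    proof (rule onorm_le)
      fix v :: 'a
      have "norm (v \<bullet> gradient_on X f z) \<le> norm v * norm (gradient_on X f z)"
        by (simp add: Cauchy_Schwarz_ineq2)
      also have "\<dots> \<le> norm v * M"
        using M[OF z] by (intro mult_left_mono) auto
      finally show "norm (v \<bullet> gradient_on X f z) \<le> M * norm v"
        by (simp add: mult.commute)
    qed
  qed
  then show ?thesis by simp
qed

text \<open>
  The difference of the averaged gradients is split as
  \<open>p x i *\<^sub>R (g i x - g i y) + (p x i - p y i) *\<^sub>R g i y\<close>. In the first part the weights are merely
  bounded by \<open>1\<close>; this is why the constants \<open>C i\<close> are summed.
\<close>

lemma Lipschitz_gradient_scaled_lse:
  fixes X :: "'a::euclidean_space set" and \<phi> :: "'i \<Rightarrow> 'a \<Rightarrow> real"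
  assumes X: "convex X" and I: "finite I" "I \<noteq> {}" and "\<mu> > 0"
    and \<phi>: "\<And>i. i \<in> I \<Longrightarrow> \<phi> i differentiable_on X"
    and M: "\<And>i. i \<in> I \<Longrightarrow> 0 \<le> M i"
      "\<And>i x. i \<in> I \<Longrightarrow> x \<in> X \<Longrightarrow> norm (gradient_on X (\<phi> i) x) \<le> M i"
    and C: "\<And>i. i \<in> I \<Longrightarrow> (C i)-lipschitz_on X (gradient_on X (\<phi> i))"
  shows "((\<Sum>i\<in>I. C i) + (\<Sum>i\<in>I. M i)\<^sup>2 / \<mu>)-lipschitz_on X
           (gradient_on X (\<lambda>x. \<mu> * lse I (\<lambda>i. \<phi> i x / \<mu>)))"
proof (rule lipschitz_onI)
  have C0: "0 \<le> C i" if "i \<in> I" for i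
    using C[OF that] by (rule lipschitz_on_nonneg)
  then show "0 \<le> (\<Sum>i\<in>I. C i) + (\<Sum>i\<in>I. M i)\<^sup>2 / \<mu>"
    using \<open>\<mu> > 0\<close> by (intro add_nonneg_nonneg sum_nonneg) auto
  fix x y assume xy: "x \<in> X" "y \<in> X"
  define g where "g i z = gradient_on X (\<phi> i) z" for i z
  define p where "p z = softmax I (\<lambda>i. \<phi> i z / \<mu>)" for z
  have grad: "gradient_on X (\<lambda>x. \<mu> * lse I (\<lambda>i. \<phi> i x / \<mu>)) z = (\<Sum>i\<in>I. p z i *\<^sub>R g i z)"
    if "z \<in> X" for z
    unfolding p_def g_def using X I \<open>\<mu> > 0\<close> \<phi> that
    by (intro gradient_scaled_lse) (auto simp: differentiable_on_def)
  have p_diff: "\<bar>p x i - p y i\<bar> \<le> (\<Sum>j\<in>I. M j) / \<mu> * norm (x - y)" if i: "i \<in> I" for i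
  proof -
    have "\<bar>p x i - p y i\<bar> \<le> (\<Sum>j\<in>I. \<bar>\<phi> j x / \<mu> - \<phi> j y / \<mu>\<bar>)"
      unfolding p_def by (rule softmax_Lipschitz[OF I(1) i])
    also have "\<dots> \<le> (\<Sum>j\<in>I. M j / \<mu> * norm (x - y))"
    proof (rule sum_mono)
      fix j assume j: "j \<in> I"
      have "\<bar>\<phi> j x - \<phi> j y\<bar> \<le> M j * norm (x - y)"
        by (rule bounded_gradient_Lipschitz[OF X \<phi>[OF j] M(2)[OF j] xy])
      then show "\<bar>\<phi> j x / \<mu> - \<phi> j y / \<mu>\<bar> \<le> M j / \<mu> * norm (x - y)"
        using \<open>\<mu> > 0\<close> by (simp add: divide_right_mono flip: diff_divide_distrib)
    qed
    finally show ?thesis by (simp add: sum_divide_distrib sum_distrib_right)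
  qed
  have "(\<Sum>i\<in>I. p x i *\<^sub>R g i x) - (\<Sum>i\<in>I. p y i *\<^sub>R g i y)
      = (\<Sum>i\<in>I. p x i *\<^sub>R (g i x - g i y) + (p x i - p y i) *\<^sub>R g i y)"
    by (simp add: algebra_simps flip: sum_subtractf)
  also have "norm \<dots> \<le> (\<Sum>i\<in>I. C i * norm (x - y) + (\<Sum>j\<in>I. M j) / \<mu> * norm (x - y) * M i)"
  proof (rule sum_norm_le)
    fix i assume i: "i \<in> I"
    have "norm (p x i *\<^sub>R (g i x - g i y)) \<le> 1 * (C i * norm (x - y))"
      unfolding norm_scaleR
    proof (rule mult_mono)
      show "\<bar>p x i\<bar> \<le> 1"
        unfolding p_def using softmax_le_1[OF I(1) i] softmax_nonneg by (metis abs_of_nonneg)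
      show "norm (g i x - g i y) \<le> C i * norm (x - y)"
        using lipschitz_onD[OF C[OF i] xy] by (simp add: g_def dist_norm)
    qed auto
    moreover have "norm ((p x i - p y i) *\<^sub>R g i y) \<le> (\<Sum>j\<in>I. M j) / \<mu> * norm (x - y) * M i"
      unfolding norm_scaleR using p_diff[OF i] M(2)[OF i xy(2)]
      by (intro mult_mono) (auto simp: g_def intro: order.trans[OF abs_ge_zero])
    ultimately show "norm (p x i *\<^sub>R (g i x - g i y) + (p x i - p y i) *\<^sub>R g i y)
        \<le> C i * norm (x - y) + (\<Sum>j\<in>I. M j) / \<mu> * norm (x - y) * M i"
      by (intro order.trans[OF norm_triangle_ineq]) simp
  qed
  also have "\<dots> = ((\<Sum>i\<in>I. C i) + (\<Sum>i\<in>I. M i)\<^sup>2 / \<mu>) * norm (x - y)"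
    unfolding sum.distrib sum_distrib_right[symmetric] sum_distrib_left[symmetric]
    by (simp add: power2_eq_square algebra_simps)
  finally show "dist (gradient_on X (\<lambda>x. \<mu> * lse I (\<lambda>i. \<phi> i x / \<mu>)) x)
      (gradient_on X (\<lambda>x. \<mu> * lse I (\<lambda>i. \<phi> i x / \<mu>)) y)
      \<le> ((\<Sum>i\<in>I. C i) + (\<Sum>i\<in>I. M i)\<^sup>2 / \<mu>) * dist x y"
    by (simp add: grad xy dist_norm)
qed

section \<open>Smoothing the maximum of convex functions\<close>

lemma convex_on_scaled_lse:
  assumes I: "finite I" "I \<noteq> {}" and "\<mu> > 0"
    and \<phi>: "\<And>i. i \<in> I \<Longrightarrow> convex_on X (\<phi> i)"
  shows "convex_on X (\<lambda>x. \<mu> * lse I (\<lambda>i. \<phi> i x / \<mu>))"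
proof (rule convex_onI)
  obtain i where "i \<in> I" using I by auto
  then show "convex X" using \<phi> convex_on_imp_convex by blast
  fix t :: real and x y assume t: "0 < t" "t < 1" and xy: "x \<in> X" "y \<in> X"
  have "lse I (\<lambda>i. \<phi> i ((1 - t) *\<^sub>R x + t *\<^sub>R y) / \<mu>)
      \<le> lse I (\<lambda>i. (1 - t) * (\<phi> i x / \<mu>) + t * (\<phi> i y / \<mu>)) + 0"
  proof (rule lse_le_shift[OF I])
    fix i assume "i \<in> I"
    from convex_onD[OF \<phi>[OF this], of t x y] t xy
    show "\<phi> i ((1 - t) *\<^sub>R x + t *\<^sub>R y) / \<mu>
        \<le> (1 - t) * (\<phi> i x / \<mu>) + t * (\<phi> i y / \<mu>) + 0"
      using \<open>\<mu> > 0\<close> by (simp add: field_simps)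
  qed
  also have "\<dots> \<le> (1 - t) * lse I (\<lambda>i. \<phi> i x / \<mu>) + t * lse I (\<lambda>i. \<phi> i y / \<mu>)"
    using lse_convex[OF I, of "1 - t" t "\<lambda>i. \<phi> i x / \<mu>" "\<lambda>i. \<phi> i y / \<mu>"] t by simp
  finally show "\<mu> * lse I (\<lambda>i. \<phi> i ((1 - t) *\<^sub>R x + t *\<^sub>R y) / \<mu>)
      \<le> (1 - t) * (\<mu> * lse I (\<lambda>i. \<phi> i x / \<mu>)) + t * (\<mu> * lse I (\<lambda>i. \<phi> i y / \<mu>))"
    using \<open>\<mu> > 0\<close> by (simp add: mult.left_commute[of _ \<mu>] flip: distrib_left)
qed

lemma convex_on_MAX:
  fixes \<phi> :: "'i \<Rightarrow> 'a::real_vector \<Rightarrow> real"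
  assumes I: "finite I" "I \<noteq> {}" and \<phi>: "\<And>i. i \<in> I \<Longrightarrow> convex_on X (\<phi> i)"
  shows "convex_on X (\<lambda>x. MAX i\<in>I. \<phi> i x)"
proof (rule convex_onI)
  obtain i where "i \<in> I" using I by auto
  then show "convex X" using \<phi> convex_on_imp_convex by blast
  fix t :: real and x y assume t: "0 < t" "t < 1" and xy: "x \<in> X" "y \<in> X"
  have "\<phi> i ((1 - t) *\<^sub>R x + t *\<^sub>R y) \<le> (1 - t) * (MAX i\<in>I. \<phi> i x) + t * (MAX i\<in>I. \<phi> i y)"
    if i: "i \<in> I" for i
  proof -
    have "\<phi> i ((1 - t) *\<^sub>R x + t *\<^sub>R y) \<le> (1 - t) * \<phi> i x + t * \<phi> i y"
      using convex_onD[OF \<phi>[OF i]] t xy by simp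
    also have "\<dots> \<le> (1 - t) * (MAX i\<in>I. \<phi> i x) + t * (MAX i\<in>I. \<phi> i y)"
      using I i t by (intro add_mono mult_left_mono Max_ge) auto
    finally show ?thesis .
  qed
  then show "(MAX i\<in>I. \<phi> i ((1 - t) *\<^sub>R x + t *\<^sub>R y))
      \<le> (1 - t) * (MAX i\<in>I. \<phi> i x) + t * (MAX i\<in>I. \<phi> i y)"
    using I by simp
qed

text \<open>
  The Euclidean norm of the \<open>\<kappa> i\<close> enters only as an upper bound for their maximum, which is what
  nonexpansiveness in the maximum norm yields.
\<close>

lemma smoothing_function_scaled_lse:
  fixes X :: "'a::euclidean_space set" and h :: "'i \<Rightarrow> 'a \<Rightarrow> real"
  assumes X: "convex X" and I: "finite I" "I \<noteq> {}"
    and conv: "\<And>i. i \<in> I \<Longrightarrow> convex_on X (h i)"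
    and ht: "\<And>i. i \<in> I \<Longrightarrow> smoothing_function X \<mu>bar (h i) (ht i) (\<kappa> i) (K i) (L i)"
    and M: "\<And>i. i \<in> I \<Longrightarrow> 0 \<le> M i"
      "\<And>i x \<mu>. i \<in> I \<Longrightarrow> x \<in> X \<Longrightarrow> \<mu> \<in> {0<..\<mu>bar} \<Longrightarrow>
         norm (gradient_on X (ht i \<mu>) x) \<le> M i"
  shows "smoothing_function X \<mu>bar (\<lambda>x. MAX i\<in>I. h i x)
           (\<lambda>\<mu> x. \<mu> * lse I (\<lambda>i. ht i \<mu> x / \<mu>))
           (ln (real (card I)) + sqrt (\<Sum>i\<in>I. (\<kappa> i)\<^sup>2))
           (\<Sum>i\<in>I. K i) ((\<Sum>i\<in>I. M i)\<^sup>2 + (\<Sum>i\<in>I. L i))"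
  unfolding smoothing_function_def
proof (intro conjI ballI)
  have kL: "\<kappa> i > 0" "L i > 0" if "i \<in> I" for i
    using ht[OF that] by (auto simp: smoothing_function_def)
  have "card I \<ge> 1"
    using I by (simp add: Suc_le_eq card_gt_0_iff)
  then have ln0: "0 \<le> ln (real (card I))" by simp
  show "convex_on X (\<lambda>x. MAX i\<in>I. h i x)"
    by (rule convex_on_MAX[OF I conv])
  have "0 < (\<Sum>i\<in>I. (\<kappa> i)\<^sup>2)"
    using I kL(1) by (intro sum_pos) fastforce+
  then show "0 < ln (real (card I)) + sqrt (\<Sum>i\<in>I. (\<kappa> i)\<^sup>2)"
    using ln0 by (simp add: add_nonneg_pos)
  show "0 < (\<Sum>i\<in>I. M i)\<^sup>2 + (\<Sum>i\<in>I. L i)"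
    using I kL(2) by (intro add_nonneg_pos sum_pos) auto
  fix x assume x: "x \<in> X"
  {
    let ?F = "at (x, 0 :: real) within X \<times> {0<..\<mu>bar}"
    have "((\<lambda>w. snd w * lse I (\<lambda>i. ht i (snd w) (fst w) / snd w)) \<longlongrightarrow> (MAX i\<in>I. h i x)) ?F"
    proof (rule tendsto_scaled_lse_MAX[OF I])
      show "((\<lambda>w. ht i (snd w) (fst w)) \<longlongrightarrow> h i x) ?F" if "i \<in> I" for i
        using ht[OF that] x unfolding smoothing_function_def case_prod_beta by blast
      show "(snd \<longlongrightarrow> 0) ?F"
        by (intro tendsto_eq_intros) auto
      show "eventually (\<lambda>w. snd w > 0) ?F"
        by (auto simp: eventually_at_filter intro: always_eventually)
    qed
    then show "((\<lambda>(z, \<mu>). \<mu> * lse I (\<lambda>i. ht i \<mu> z / \<mu>)) \<longlongrightarrow> (MAX i\<in>I. h i x)) ?F"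
      by (simp only: case_prod_unfold)
  next
    fix s t assume st: "s \<in> {0<..\<mu>bar}" "t \<in> {0<..\<mu>bar}"
    have "\<bar>t * lse I (\<lambda>i. ht i t x / t) - s * lse I (\<lambda>i. ht i s x / s)\<bar>
        \<le> \<bar>s - t\<bar> * ln (real (card I)) + sqrt (\<Sum>i\<in>I. (\<kappa> i)\<^sup>2) * \<bar>s - t\<bar>"
    proof (rule scaled_lse_joint_Lipschitz[OF I])
      fix i assume i: "i \<in> I"
      have "\<bar>ht i t x - ht i s x\<bar> \<le> \<kappa> i * \<bar>s - t\<bar>"
        using ht[OF i] x st by (auto simp: smoothing_function_def)
      also have "(\<kappa> i)\<^sup>2 \<le> (\<Sum>i\<in>I. (\<kappa> i)\<^sup>2)"
        using I i by (intro member_le_sum) auto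
      then have "\<kappa> i * \<bar>s - t\<bar> \<le> sqrt (\<Sum>i\<in>I. (\<kappa> i)\<^sup>2) * \<bar>s - t\<bar>"
        by (intro mult_right_mono real_le_rsqrt) auto
      finally show "\<bar>ht i t x - ht i s x\<bar> \<le> sqrt (\<Sum>i\<in>I. (\<kappa> i)\<^sup>2) * \<bar>s - t\<bar>" .
    qed (use st in auto)
    then show "\<bar>t * lse I (\<lambda>i. ht i t x / t) - s * lse I (\<lambda>i. ht i s x / s)\<bar>
        \<le> (ln (real (card I)) + sqrt (\<Sum>i\<in>I. (\<kappa> i)\<^sup>2)) * \<bar>s - t\<bar>"
      by (simp add: algebra_simps)
  }
next
  fix \<mu> assume \<mu>: "\<mu> \<in> {0<..\<mu>bar}"
  then have \<mu>0: "\<mu> > 0" by simp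
  have diff: "ht i \<mu> differentiable_on X"
    and conv_ht: "convex_on X (ht i \<mu>)"
    and lip_ht: "(K i + L i / \<mu>)-lipschitz_on X (gradient_on X (ht i \<mu>))" if "i \<in> I" for i
    using ht[OF that] \<mu> by (auto simp: smoothing_function_def)
  show "(\<lambda>x. \<mu> * lse I (\<lambda>i. ht i \<mu> x / \<mu>)) differentiable_on X"
    using diff unfolding differentiable_on_def
    by (intro ballI gradient_scaled_lse(1)[OF X _ I \<mu>0]) auto
  show "convex_on X (\<lambda>x. \<mu> * lse I (\<lambda>i. ht i \<mu> x / \<mu>))"
    by (rule convex_on_scaled_lse[OF I \<mu>0 conv_ht])
  have "((\<Sum>i\<in>I. K i + L i / \<mu>) + (\<Sum>i\<in>I. M i)\<^sup>2 / \<mu>)-lipschitz_on X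
      (gradient_on X (\<lambda>x. \<mu> * lse I (\<lambda>i. ht i \<mu> x / \<mu>)))"
    using Lipschitz_gradient_scaled_lse[OF X I \<mu>0 diff M(1) M(2)[OF _ _ \<mu>] lip_ht] .
  also have "(\<Sum>i\<in>I. K i + L i / \<mu>) + (\<Sum>i\<in>I. M i)\<^sup>2 / \<mu>
      = (\<Sum>i\<in>I. K i) + ((\<Sum>i\<in>I. M i)\<^sup>2 + (\<Sum>i\<in>I. L i)) / \<mu>"
    by (simp add: sum.distrib add_divide_distrib flip: sum_divide_distrib)
  finally show lip: "((\<Sum>i\<in>I. K i) + ((\<Sum>i\<in>I. M i)\<^sup>2 + (\<Sum>i\<in>I. L i)) / \<mu>)-lipschitz_on X
      (gradient_on X (\<lambda>x. \<mu> * lse I (\<lambda>i. ht i \<mu> x / \<mu>)))" .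
  show "continuous_on X (gradient_on X (\<lambda>x. \<mu> * lse I (\<lambda>i. ht i \<mu> x / \<mu>)))"
    using lip by (rule lipschitz_on_continuous_on)
qed

section \<open>Unbiasedness and variance of the random gradient\<close>

lemma log_sum_exp_smoothing_eq:
  "log_sum_exp_smoothing q ht = (\<lambda>\<mu> x. \<mu> * lse {1..q} (\<lambda>i. ht i \<mu> x / \<mu>))"
  by (intro ext) (simp add: log_sum_exp_smoothing_def lse_def)

lemma expectation_index_pmf:
  fixes F :: "nat \<Rightarrow> 'b::euclidean_space"
  assumes "q \<ge> 1"
  shows "measure_pmf.expectation (index_pmf q ht x \<mu>) F
       = (\<Sum>i=1..q. softmax {1..q} (\<lambda>i. ht i \<mu> x / \<mu>) i *\<^sub>R F i)"
proof -
  have "measure_pmf.expectation (index_pmf q ht x \<mu>) F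
      = (\<Sum>i=1..q. pmf (index_pmf q ht x \<mu>) i *\<^sub>R F i)"
    using assms
    by (intro integral_measure_pmf) (auto simp: set_pmf_iff pmf_index_pmf index_prob_def split: if_splits)
  also have "\<dots> = (\<Sum>i=1..q. softmax {1..q} (\<lambda>i. ht i \<mu> x / \<mu>) i *\<^sub>R F i)"
    using assms by (intro sum.cong) (auto simp: pmf_index_pmf index_prob_def softmax_def)
  finally show ?thesis .
qed

lemma gradient_on_add:
  fixes X :: "'a::euclidean_space set"
  assumes X: "convex X" "x \<in> X"
    and f: "f differentiable (at x within X)" and g: "g differentiable (at x within X)"
  shows "gradient_on X (\<lambda>x. f x + g x) x = gradient_on X f x + gradient_on X g x"
proof (rule gradient_on_eqI[OF X])
  show "gradient_on X f x + gradient_on X g x \<in> span ((\<lambda>y. y - x) ` X)"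
    using gradient_on_works(1)[OF X f] gradient_on_works(1)[OF X g] by (rule span_add)
  show "((\<lambda>x. f x + g x) has_derivative
      (\<lambda>v. v \<bullet> (gradient_on X f x + gradient_on X g x))) (at x within X)"
    unfolding inner_add_right
    using gradient_on_works(2)[OF X f] gradient_on_works(2)[OF X g] by (rule has_derivative_add)
qed

text \<open>
  The two sides differ by \<open>(norm m)\<^sup>2\<close>.
\<close>

lemma weighted_variance_le:
  fixes g :: "'i \<Rightarrow> 'a::real_inner"
  assumes p: "(\<Sum>i\<in>I. p i) = 1"
  defines "m \<equiv> \<Sum>i\<in>I. p i *\<^sub>R g i"
  shows "(\<Sum>i\<in>I. p i * (norm (g i - m))\<^sup>2) \<le> (\<Sum>i\<in>I. p i * (norm (g i))\<^sup>2)"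
proof -
  have "(\<Sum>i\<in>I. p i * (norm (g i - m))\<^sup>2)
      = (\<Sum>i\<in>I. p i * (norm (g i))\<^sup>2 - 2 * (p i * (g i \<bullet> m)) + p i * (norm m)\<^sup>2)"
    by (intro sum.cong)
      (simp_all add: power2_norm_eq_inner inner_diff_left inner_diff_right inner_commute algebra_simps)
  also have "\<dots> = (\<Sum>i\<in>I. p i * (norm (g i))\<^sup>2) - 2 * (m \<bullet> m) + (norm m)\<^sup>2"
    by (simp add: sum.distrib sum_subtractf p m_def inner_sum_left
          flip: sum_distrib_left sum_distrib_right)
  finally show ?thesis
    by (simp add: power2_norm_eq_inner)
qed

theorem lemma5:
  fixes X :: "'a::euclidean_space set"
    and \<mu>bar :: real
    and q :: nat
    and f :: "'a \<Rightarrow> real"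
    and h :: "nat \<Rightarrow> 'a \<Rightarrow> real"
    and ht :: "nat \<Rightarrow> real \<Rightarrow> 'a \<Rightarrow> real"
    and \<kappa> K L M :: "nat \<Rightarrow> real"
  assumes "closed X" and "convex X" and "\<mu>bar > 0" and "q \<ge> 1"
    and "convex_on X f" and "f differentiable_on X"
    and "\<exists>C. C-lipschitz_on X (gradient_on X f)"
    and "\<And>i. i \<in> {1..q} \<Longrightarrow> convex_on X (h i)"
    and "\<And>i. i \<in> {1..q} \<Longrightarrow> smoothing_function X \<mu>bar (h i) (ht i) (\<kappa> i) (K i) (L i)"
    and "\<And>i. i \<in> {1..q} \<Longrightarrow> M i \<ge> 0"
    and "\<And>i x \<mu>. i \<in> {1..q} \<Longrightarrow> x \<in> X \<Longrightarrow> \<mu> \<in> {0<..\<mu>bar} \<Longrightarrow>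
           norm (gradient_on X (ht i \<mu>) x) \<le> M i"
  shows "smoothing_function X \<mu>bar (\<lambda>x. MAX i\<in>{1..q}. h i x) (log_sum_exp_smoothing q ht)
           (ln (real q) + sqrt (\<Sum>i=1..q. (\<kappa> i)\<^sup>2))
           (\<Sum>i=1..q. K i)
           ((\<Sum>i=1..q. M i)\<^sup>2 + (\<Sum>i=1..q. L i))
       \<and> unbiased_bounded_variance X \<mu>bar (\<lambda>\<mu> x. f x + log_sum_exp_smoothing q ht \<mu> x)
           (index_pmf q ht) (stochastic_gradient X f ht)
           (\<lambda>x \<mu>. measure_pmf.expectation (index_pmf q ht x \<mu>) (\<lambda>i. (M i)\<^sup>2))"
proof
  have I: "finite {1..q}" "{1..q} \<noteq> {}"
    using \<open>q \<ge> 1\<close> by auto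
  show "smoothing_function X \<mu>bar (\<lambda>x. MAX i\<in>{1..q}. h i x) (log_sum_exp_smoothing q ht)
      (ln (real q) + sqrt (\<Sum>i=1..q. (\<kappa> i)\<^sup>2)) (\<Sum>i=1..q. K i)
      ((\<Sum>i=1..q. M i)\<^sup>2 + (\<Sum>i=1..q. L i))"
    using smoothing_function_scaled_lse[OF \<open>convex X\<close> I assms(8-11)]
    by (simp add: log_sum_exp_smoothing_eq)
  show "unbiased_bounded_variance X \<mu>bar (\<lambda>\<mu> x. f x + log_sum_exp_smoothing q ht \<mu> x)
      (index_pmf q ht) (stochastic_gradient X f ht)
      (\<lambda>x \<mu>. measure_pmf.expectation (index_pmf q ht x \<mu>) (\<lambda>i. (M i)\<^sup>2))"
    unfolding unbiased_bounded_variance_def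
  proof (intro ballI)
    fix x \<mu> assume x: "x \<in> X" and \<mu>: "\<mu> \<in> {0<..\<mu>bar}"
    then have \<mu>0: "\<mu> > 0" by simp
    define p where "p = softmax {1..q} (\<lambda>i. ht i \<mu> x / \<mu>)"
    define g where "g i = gradient_on X (ht i \<mu>) x" for i
    define m where "m = (\<Sum>i=1..q. p i *\<^sub>R g i)"
    have p1: "(\<Sum>i=1..q. p i) = 1"
      unfolding p_def by (rule sum_softmax[OF I])
    have diff: "ht i \<mu> differentiable (at x within X)" if "i \<in> {1..q}" for i
      using assms(9)[OF that] x \<mu> by (auto simp: smoothing_function_def differentiable_on_def)
    have f: "f differentiable (at x within X)"
      using \<open>f differentiable_on X\<close> x by (simp add: differentiable_on_def)
    have lse: "log_sum_exp_smoothing q ht \<mu> differentiable (at x within X)"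
      "gradient_on X (log_sum_exp_smoothing q ht \<mu>) x = m"
      unfolding log_sum_exp_smoothing_eq m_def p_def g_def
      by (rule gradient_scaled_lse[OF \<open>convex X\<close> x I \<mu>0 diff]; simp)+
    have grad: "gradient_on X (\<lambda>x. f x + log_sum_exp_smoothing q ht \<mu> x) x = gradient_on X f x + m"
      using gradient_on_add[OF \<open>convex X\<close> x f lse(1)] lse(2) by simp
    have "measure_pmf.expectation (index_pmf q ht x \<mu>) (\<lambda>i. stochastic_gradient X f ht \<mu> x i)
        = (\<Sum>i=1..q. p i *\<^sub>R (gradient_on X f x + g i))"
      by (simp add: expectation_index_pmf[OF \<open>q \<ge> 1\<close>] p_def g_def stochastic_gradient_def)
    also have "\<dots> = gradient_on X f x + m"
      using p1 by (simp add: m_def scaleR_add_right sum.distrib flip: scaleR_sum_left)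
    finally have unbiased: "measure_pmf.expectation (index_pmf q ht x \<mu>)
        (\<lambda>i. stochastic_gradient X f ht \<mu> x i) = gradient_on X f x + m" .
    have "measure_pmf.expectation (index_pmf q ht x \<mu>)
        (\<lambda>i. (norm (stochastic_gradient X f ht \<mu> x i - (gradient_on X f x + m)))\<^sup>2)
        = (\<Sum>i=1..q. p i * (norm (g i - m))\<^sup>2)"
      by (simp add: expectation_index_pmf[OF \<open>q \<ge> 1\<close>] p_def g_def stochastic_gradient_def)
    also have "\<dots> \<le> (\<Sum>i=1..q. p i * (norm (g i))\<^sup>2)"
      unfolding m_def by (rule weighted_variance_le[OF p1])
    also have "\<dots> \<le> (\<Sum>i=1..q. p i * (M i)\<^sup>2)"
      using assms(11)[OF _ x \<mu>]
      by (intro sum_mono mult_left_mono power_mono) (auto simp: p_def g_def softmax_nonneg)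
    also have "\<dots> = measure_pmf.expectation (index_pmf q ht x \<mu>) (\<lambda>i. (M i)\<^sup>2)"
      by (simp add: expectation_index_pmf[OF \<open>q \<ge> 1\<close>] p_def)
    finally show "measure_pmf.expectation (index_pmf q ht x \<mu>)
          (\<lambda>i. stochastic_gradient X f ht \<mu> x i)
        = gradient_on X (\<lambda>x. f x + log_sum_exp_smoothing q ht \<mu> x) x \<and>
      measure_pmf.expectation (index_pmf q ht x \<mu>)
          (\<lambda>i. (norm (stochastic_gradient X f ht \<mu> x i
             - gradient_on X (\<lambda>x. f x + log_sum_exp_smoothing q ht \<mu> x) x))\<^sup>2)
        \<le> measure_pmf.expectation (index_pmf q ht x \<mu>) (\<lambda>i. (M i)\<^sup>2)"
      unfolding grad using unbiased by simp
  qed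
qed

end
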